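(* Let $u \in L^1_0(\mathbb{R}^N)$. If $u$ is Dini continuous at some $x \in \mathbb{R}^N$, then $[L_\Delta u](x)$ is well-defined by the formula $$L_\Delta u(x)= c_{N} \int_{\mathbb{R}^N} \frac{ u(x)1_{B_1(x)}(y)-u(y)}{|x-y|^{N} }\, dy + \rho_N u(x)$$ (i.e. the integral exists as a Lebesgue integral). Moreover, if $u$ is uniformly Dini continuous in some open subset $\Omega \subset \mathbb{R}^N$, then $L_\Delta u$ is continuous in $\Omega$.
   Context: $N\ge1$; $c_N= \pi^{-N/2}\Gamma(N/2)$, $\rho_N=2 \log 2 + \psi(\frac{N}{2}) -\gamma$, with $\psi=\Gamma'/\Gamma$ and $\gamma=-\Gamma'(1)$. $B_1(x)$ is the open unit ball centered at $x$ and $1_A$ the indicator function of $A$. $L^1_0(\mathbb{R}^N)$ is the space of locally integrable functions $u:\mathbb{R}^N\to\mathbb{R}$ with $\|u\|_{L^1_0}:=\int_{\mathbb{R}^N}\frac{|u(x)|}{(1+|x|)^N}\,dx<\infty$. For a measurable set $\Omega\subset\mathbb{R}^N$, a measurable function $u:\Omega\to\mathbb{R}$ and $x\in\Omega$, the module of continuity at $x$ is $\omega_{u,x,\Omega}(r)=\sup_{y\in\Omega,\,|y-x|\le r}|u(y)-u(x)|$, $r>0$. The function $u$ is Dini continuous at $x$ if $\int_0^1\frac{\omega_{u,x,\Omega}(r)}{r}\,dr<\infty$ (for $u$ defined on $\mathbb{R}^N$, take $\Omega=\mathbb{R}^N$). It is uniformly Dini continuous in $\Omega$ if $\int_0^1\frac{\omega_{u,\Omega}(r)}{r}\,dr<\infty$,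 where $\omega_{u,\Omega}(r):=\sup_{x\in\Omega}\omega_{u,x,\Omega}(r)$; for $u$ defined on $\mathbb{R}^N$ this refers to the restriction of $u$ to $\Omega$. *)

theory Defs
  imports "HOL-Analysis.Analysis"
begin

text \<open>
  The space \<open>\<real>\<^sup>N\<close> is a type \<open>'a\<close> of class \<^class>\<open>euclidean_space\<close>, with
  \<open>N = DIM('a) \<ge> 1\<close>; measurability and integrals over it refer to \<^const>\<open>lebesgue\<close>.
\<close>

definition c_const :: "nat \<Rightarrow> real" where
  "c_const N = pi powr (- (real N / 2)) * Gamma (real N / 2)"

definition rho_const :: "nat \<Rightarrow> real" where
  "rho_const N = 2 * ln 2 + Digamma (real N / 2) - euler_mascheroni"

text \<open>
  The two special constants agree with their descriptions through derivatives of \<^const>\<open>Gamma\<close>.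
\<close>

lemma Digamma_eq_deriv_Gamma:
  fixes x :: real
  assumes "x > 0"
  shows "Digamma x = deriv Gamma x / Gamma x"
proof -
  have nz: "x \<notin> \<int>\<^sub>\<le>\<^sub>0"
    using assms by (auto elim!: nonpos_Ints_cases)
  have "deriv Gamma x = Gamma x * Digamma x"
    by (rule DERIV_imp_deriv) (rule has_field_derivative_Gamma[OF nz])
  then show ?thesis
    using Gamma_real_pos[OF assms] by simp
qed

lemma euler_mascheroni_eq_deriv_Gamma: "euler_mascheroni = - deriv Gamma (1::real)"
  using Digamma_eq_deriv_Gamma[of 1] by (simp add: Digamma_1)

definition locally_integrable :: "('a::euclidean_space \<Rightarrow> real) \<Rightarrow> bool" where
  "locally_integrable u \<longleftrightarrow> (\<forall>K. compact K \<longrightarrow> set_integrable lebesgue K u)"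

definition L10_norm :: "('a::euclidean_space \<Rightarrow> real) \<Rightarrow> ennreal" where
  "L10_norm u = (\<integral>\<^sup>+ x. ennreal (\<bar>u x\<bar> / (1 + norm x) ^ DIM('a)) \<partial>lebesgue)"

definition L10 :: "('a::euclidean_space \<Rightarrow> real) set" where
  "L10 = {u. locally_integrable u \<and> L10_norm u < \<infinity>}"

text \<open>
  The moduli of continuity take values in \<open>[0, \<infinity>]\<close>: the suprema may be infinite, in which case
  the corresponding Dini integral is infinite as well. Only the values of \<open>u\<close> on \<open>\<Omega>\<close> enter, so a
  function on \<open>\<Omega>\<close> is represented by any total extension of it.
\<close>

definition modulus_at :: "('a::euclidean_space \<Rightarrow> real) \<Rightarrow> 'a \<Rightarrow> 'a set \<Rightarrow> real \<Rightarrow> ennreal" where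
  "modulus_at u x \<Omega> r = (SUP y \<in> {y \<in> \<Omega>. norm (y - x) \<le> r}. ennreal \<bar>u y - u x\<bar>)"

definition modulus_on :: "('a::euclidean_space \<Rightarrow> real) \<Rightarrow> 'a set \<Rightarrow> real \<Rightarrow> ennreal" where
  "modulus_on u \<Omega> r = (SUP x \<in> \<Omega>. modulus_at u x \<Omega> r)"

definition dini_continuous_at :: "('a::euclidean_space \<Rightarrow> real) \<Rightarrow> 'a set \<Rightarrow> 'a \<Rightarrow> bool" where
  "dini_continuous_at u \<Omega> x \<longleftrightarrow>
     (\<integral>\<^sup>+ r \<in> {0<..<1}. modulus_at u x \<Omega> r / ennreal r \<partial>lborel) < \<infinity>"

definition uniformly_dini_continuous_on :: "('a::euclidean_space \<Rightarrow> real) \<Rightarrow> 'a set \<Rightarrow> bool" where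
  "uniformly_dini_continuous_on u \<Omega> \<longleftrightarrow>
     (\<integral>\<^sup>+ r \<in> {0<..<1}. modulus_on u \<Omega> r / ennreal r \<partial>lborel) < \<infinity>"

text \<open>
  At \<open>y = x\<close> the quotient is \<open>0\<close> by the convention for division by zero; this concerns a null set
  only. Where the integrand is not integrable, \<open>L_Delta u x\<close> has no meaning (the Bochner
  integral then defaults to \<open>0\<close>), so well-definedness is the predicate \<open>L_Delta_defined\<close>.
\<close>

definition L_Delta_integrand :: "('a::euclidean_space \<Rightarrow> real) \<Rightarrow> 'a \<Rightarrow> 'a \<Rightarrow> real" where
  "L_Delta_integrand u x y =
     (u x * indicator (ball x 1) y - u y) / norm (x - y) ^ DIM('a)"

definition L_Delta_defined :: "('a::euclidean_space \<Rightarrow> real) \<Rightarrow> 'a \<Rightarrow> bool" where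
  "L_Delta_defined u x \<longleftrightarrow> integrable lebesgue (L_Delta_integrand u x)"

definition L_Delta :: "('a::euclidean_space \<Rightarrow> real) \<Rightarrow> 'a \<Rightarrow> real" where
  "L_Delta u x =
     c_const DIM('a) * (\<integral>y. L_Delta_integrand u x y \<partial>lebesgue) + rho_const DIM('a) * u x"

end

theory Submission
  imports Defs
begin

text \<open>
  Near \<open>x\<close> the integrand is at most \<open>m |y - x| / |y - x|\<^sup>N\<close> with \<open>m\<close> a modulus of continuity. Since
  \<open>m\<close> is nondecreasing, \<open>m s \<le> 2 \<integral> m r / r dr\<close> over \<open>s < r < 2 s\<close>, and Tonelli bounds the
  contribution of the ball of radius \<open>\<delta>\<close> around \<open>x\<close> by a multiple of \<open>\<integral> m r / r dr\<close> over
  \<open>0 < r < 2 \<delta>\<close>, without polar coordinates. Away from \<open>x\<close> the integrand is dominated by the weight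
  of \<open>L\<^sup>1\<^sub>0\<close>. Under the uniform Dini condition the near part is small uniformly in \<open>x\<close> while, by
  dominated convergence, the far part is continuous in \<open>x\<close>; so the integral is continuous.
\<close>

section \<open>Monotone moduli and their Dini integrals\<close>

text \<open>Superlevel sets of a monotone function are intervals. The moduli of continuity are
  suprema over uncountable families, so their measurability is drawn from monotonicity.\<close>

lemma borel_measurable_mono_ennreal:
  fixes m :: "real \<Rightarrow> ennreal"
  assumes "mono m"
  shows "m \<in> borel_measurable borel"
proof (rule borel_measurableI_greater)
  fix a
  have "is_interval {r. a < m r}"
    using monoD[OF assms] unfolding is_interval_1 by (blast intro: order.strict_trans2)
  then show "{r \<in> space borel. a < m r} \<in> sets borel"
    by (simp add: real_interval_borel_measurable)
qed

text \<open>On \<open>{s<..<2 * s}\<close> monotonicity gives \<open>m r \<ge> m s\<close>, the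
  weight \<open>1 / r\<close> is at least \<open>1 / (2 * s)\<close>, and the interval has length
  \<open>s\<close>; so the integral is at least half of \<open>m s\<close>.\<close>

lemma mono_le_dyadic_nn_integral:
  fixes m :: "real \<Rightarrow> ennreal"
  assumes m: "mono m" and s: "0 < s"
  shows "m s \<le> 2 * (\<integral>\<^sup>+r\<in>{s<..<2 * s}. m r / ennreal r \<partial>lborel)"
proof -
  have "m s = 2 * (\<integral>\<^sup>+r\<in>{s<..<2 * s}. m s * ennreal (1 / (2 * s)) \<partial>lborel)"
  proof -
    have "(\<integral>\<^sup>+r\<in>{s<..<2 * s}. m s * ennreal (1 / (2 * s)) \<partial>lborel) = m s * ennreal (1 / (2 * s)) * ennreal s"
      using s by (simp add: nn_integral_cmult_indicator)
    also have "\<dots> = m s * ennreal (1/2)"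
      using s by (simp add: mult.assoc flip: ennreal_mult)
    also have "2 * \<dots> = m s * (ennreal 2 * ennreal (1/2))"
      by (simp add: ac_simps)
    also have "ennreal 2 * ennreal (1/2) = 1"
      by (subst ennreal_mult[symmetric]) auto
    finally show ?thesis by simp
  qed
  also have "\<dots> \<le> 2 * (\<integral>\<^sup>+r\<in>{s<..<2 * s}. m r / ennreal r \<partial>lborel)"
  proof (intro mult_left_mono nn_integral_mono)
    fix r
    show "m s * ennreal (1 / (2 * s)) * indicator {s<..<2 * s} r
        \<le> m r / ennreal r * indicator {s<..<2 * s} r"
      using s by (auto simp: indicator_def divide_ennreal_def inverse_ennreal divide_simps
          intro!: mult_mono monoD[OF m] ennreal_leI)
  qed auto
  finally show ?thesis .
qed

text \<open>With \<open>s = norm (y - x)\<close> and N the dimension, \<open>m s\<close> is replaced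
  by its dyadic integral and Tonelli swaps \<open>r\<close> and \<open>y\<close>. For fixed
  \<open>r\<close> the relevant \<open>y\<close> lie in \<open>cball x r\<close>, whose volume, a
  multiple of \<open>r ^ N\<close>, cancels the weight. In the constant, one factor 2 comes from the
  dyadic bound and \<open>2 ^ N\<close> from comparing \<open>1 / s ^ N\<close> with
  \<open>1 / r ^ N\<close> for \<open>r < 2 * s\<close>.\<close>

lemma nn_integral_radial_le:
  fixes m :: "real \<Rightarrow> ennreal" and x :: "'a::euclidean_space"
  assumes m: "mono m"
  shows "(\<integral>\<^sup>+y\<in>ball x \<delta>. m (norm (y - x)) * ennreal (1 / norm (y - x) ^ DIM('a)) \<partial>lborel)
    \<le> ennreal (2 ^ (DIM('a) + 1) * unit_ball_vol (real DIM('a)))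
        * (\<integral>\<^sup>+r\<in>{0<..<2 * \<delta>}. m r / ennreal r \<partial>lborel)"
proof -
  let ?N = "DIM('a)"
  have [measurable]: "m \<in> borel_measurable borel"
    using m by (rule borel_measurable_mono_ennreal)
  \<comment> \<open>The dyadic condition \<open>s < r < 2 * s\<close> with
    \<open>s < \<delta>\<close> is relaxed to \<open>s \<le> r\<close> and
    \<open>0 < r < 2 * \<delta>\<close>, and the weight now depends on \<open>r\<close> alone. The
    inner integral over \<open>y\<close> thus reduces to the volume of a ball.\<close>
  define f where "f r y = (m r / ennreal r * indicator {0<..<2 * \<delta>} r) *
      (ennreal (2 ^ (?N + 1) / r ^ ?N) * (if norm (y - x) \<le> r then 1 else 0))" for r and y :: 'a
  have f_meas: "case_prod f \<in> borel_measurable (lborel \<Otimes>\<^sub>M lborel)"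
    unfolding f_def by measurable
  have "(\<integral>\<^sup>+y\<in>ball x \<delta>. m (norm (y - x)) * ennreal (1 / norm (y - x) ^ ?N) \<partial>lborel)
      \<le> (\<integral>\<^sup>+y. (\<integral>\<^sup>+r. f r y \<partial>lborel) \<partial>lborel)"
  proof (rule nn_integral_mono)
    fix y
    define s where "s = norm (y - x)"
    show "m (norm (y - x)) * ennreal (1 / norm (y - x) ^ ?N) * indicator (ball x \<delta>) y
      \<le> (\<integral>\<^sup>+r. f r y \<partial>lborel)"
    proof (cases "y \<noteq> x \<and> y \<in> ball x \<delta>")
      case True
      then have s: "0 < s" "s < \<delta>" by (auto simp: s_def dist_norm norm_minus_commute)
      have "m s * ennreal (1 / s ^ ?N)
          \<le> 2 * (\<integral>\<^sup>+r\<in>{s<..<2 * s}. m r / ennreal r \<partial>lborel) * ennreal (1 / s ^ ?N)"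
        using mono_le_dyadic_nn_integral[OF m s(1)] by (rule mult_right_mono) simp
      also have "\<dots> = (\<integral>\<^sup>+r. (m r / ennreal r * indicator {s<..<2 * s} r) * ennreal (2 / s ^ ?N) \<partial>lborel)"
      proof -
        have "ennreal (2 / s ^ ?N) = 2 * ennreal (1 / s ^ ?N)"
          using s ennreal_mult[of 2 "1 / s ^ ?N"] by simp
        then show ?thesis
          by (subst nn_integral_multc) (simp_all add: ac_simps)
      qed
      also have "\<dots> \<le> (\<integral>\<^sup>+r. f r y \<partial>lborel)"
      proof (rule nn_integral_mono)
        fix r
        show "(m r / ennreal r * indicator {s<..<2 * s} r) * ennreal (2 / s ^ ?N) \<le> f r y"
        proof (cases "s < r \<and> r < 2 * s")
          case True
          then have "r ^ ?N \<le> (2 * s) ^ ?N"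
            using s by (intro power_mono) auto
          then have "2 / s ^ ?N \<le> 2 ^ (?N + 1) / r ^ ?N"
            using s True by (simp add: divide_simps power_mult_distrib mult.commute)
          then show ?thesis
            using True s unfolding f_def
            by (auto simp: s_def[symmetric] intro!: mult_left_mono ennreal_leI)
        qed auto
      qed
      finally show ?thesis using True by (simp add: s_def)
    \<comment> \<open>At \<open>y = x\<close> the weight is \<open>1 / 0\<close>, which is 0 by
      convention because the dimension is positive.\<close>
    qed (auto simp: power_0_left)
  qed
  also have "\<dots> = (\<integral>\<^sup>+r. (\<integral>\<^sup>+y. f r y \<partial>lborel) \<partial>lborel)"
    using f_meas by (rule lborel_pair.Fubini')
  also have "\<dots> = (\<integral>\<^sup>+r. (m r / ennreal r * indicator {0<..<2 * \<delta>} r)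
      * ennreal (2 ^ (?N + 1) * unit_ball_vol ?N) \<partial>lborel)"
  proof (rule nn_integral_cong)
    fix r
    show "(\<integral>\<^sup>+y. f r y \<partial>lborel) = (m r / ennreal r * indicator {0<..<2 * \<delta>} r)
      * ennreal (2 ^ (?N + 1) * unit_ball_vol ?N)"
    proof (cases "0 < r")
      case True
      have "(\<integral>\<^sup>+y. (if norm (y - x) \<le> r then 1 else 0) \<partial>lborel) = (\<integral>\<^sup>+y. indicator (cball x r) y \<partial>lborel)"
        by (rule nn_integral_cong) (auto simp: dist_norm norm_minus_commute)
      also have "\<dots> = ennreal (unit_ball_vol ?N * r ^ ?N)"
        using True by (simp add: emeasure_cball)
      finally have "(\<integral>\<^sup>+y. f r y \<partial>lborel) = (m r / ennreal r * indicator {0<..<2 * \<delta>} r) *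
          (ennreal (2 ^ (?N + 1) / r ^ ?N) * ennreal (unit_ball_vol ?N * r ^ ?N))"
        unfolding f_def by (simp add: nn_integral_cmult)
      also have "ennreal (2 ^ (?N + 1) / r ^ ?N) * ennreal (unit_ball_vol ?N * r ^ ?N)
          = ennreal (2 ^ (?N + 1) * unit_ball_vol ?N)"
        using True by (subst ennreal_mult[symmetric]) (auto simp: field_simps)
      finally show ?thesis .
    qed (simp add: f_def)
  qed
  also have "\<dots> = ennreal (2 ^ (?N + 1) * unit_ball_vol ?N)
        * (\<integral>\<^sup>+r\<in>{0<..<2 * \<delta>}. m r / ennreal r \<partial>lborel)"
    by (subst nn_integral_multc) (simp_all add: mult.commute)
  finally show ?thesis .
qed

text \<open>Dominated convergence along the intervals \<open>{0<..<1 / (n + 1)}\<close>: each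
  \<open>r\<close> leaves them eventually, and the finite integral over \<open>{0<..<1}\<close>
  supplies the majorant.\<close>

lemma dini_integral_small:
  fixes m :: "real \<Rightarrow> ennreal"
  assumes m: "mono m" and fin: "(\<integral>\<^sup>+r\<in>{0<..<1}. m r / ennreal r \<partial>lborel) < \<infinity>" and e: "0 < e"
  obtains t where "0 < t" "t \<le> 1" "(\<integral>\<^sup>+r\<in>{0<..<t}. m r / ennreal r \<partial>lborel) < ennreal e"
proof -
  let ?f = "\<lambda>r. m r / ennreal r"
  have [measurable]: "m \<in> borel_measurable borel"
    using m by (rule borel_measurable_mono_ennreal)
  have "(\<lambda>n. \<integral>\<^sup>+r\<in>{0<..<inverse (real (Suc n))}. ?f r \<partial>lborel) \<longlonglongrightarrow> (\<integral>\<^sup>+r. 0 \<partial>(lborel::real measure))"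
  proof (rule nn_integral_dominated_convergence[where w = "\<lambda>r. ?f r * indicator {0<..<1} r"])
    have le: "inverse (real (Suc n)) \<le> 1" for n
      by (simp add: field_simps)
    show "AE r in lborel. ?f r * indicator {0<..<inverse (real (Suc n))} r \<le> ?f r * indicator {0<..<1} r" for n
      by (intro AE_I2 mult_left_mono indicator_leI)
        (auto simp del: of_nat_Suc intro: order.strict_trans2[OF _ le])
    show "AE r in lborel. (\<lambda>n. ?f r * indicator {0<..<inverse (real (Suc n))} r) \<longlonglongrightarrow> 0"
    proof (intro AE_I2 tendsto_eventually)
      fix r :: real
      show "\<forall>\<^sub>F n in sequentially. ?f r * indicator {0<..<inverse (real (Suc n))} r = 0"
      proof (cases "0 < r")
        case True
        then have "\<forall>\<^sub>F n in sequentially. inverse (real (Suc n)) < r"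
          using LIMSEQ_inverse_real_of_nat by (rule order_tendstoD(2)[rotated])
        then show ?thesis
          by eventually_elim (auto simp: indicator_def)
      qed simp
    qed
  qed (use fin in auto)
  then have "(\<lambda>n. \<integral>\<^sup>+r\<in>{0<..<inverse (real (Suc n))}. ?f r \<partial>lborel) \<longlonglongrightarrow> 0" by simp
  then have "\<forall>\<^sub>F n in sequentially.
      (\<integral>\<^sup>+r\<in>{0<..<inverse (real (Suc n))}. ?f r \<partial>lborel) < ennreal e"
    using e by (intro order_tendstoD(2)) auto
  then obtain n where "(\<integral>\<^sup>+r\<in>{0<..<inverse (real (Suc n))}. ?f r \<partial>lborel) < ennreal e"
    by (meson eventually_sequentially order_refl)
  then show thesis by (intro that[of "inverse (real (Suc n))"]) (auto simp: field_simps)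
qed

section \<open>Moduli of continuity and uniform Dini continuity\<close>

lemma mono_modulus_at: "mono (modulus_at u x \<Omega>)"
  unfolding modulus_at_def by (intro monoI SUP_subset_mono) auto

lemma mono_modulus_on: "mono (modulus_on u \<Omega>)"
  unfolding modulus_on_def by (intro monoI SUP_mono') (rule monoD[OF mono_modulus_at])

lemma modulus_at_upper: "y \<in> \<Omega> \<Longrightarrow> ennreal \<bar>u y - u x\<bar> \<le> modulus_at u x \<Omega> (norm (y - x))"
  unfolding modulus_at_def by (rule SUP_upper) simp

lemma modulus_at_le_modulus_on: "x \<in> \<Omega> \<Longrightarrow> modulus_at u x \<Omega> r \<le> modulus_on u \<Omega> r"
  unfolding modulus_on_def by (rule SUP_upper)

lemma uniformly_dini_imp_dini:
  assumes "uniformly_dini_continuous_on u \<Omega>" "x \<in> \<Omega>"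
  shows "dini_continuous_at u \<Omega> x"
proof -
  have "(\<integral>\<^sup>+r\<in>{0<..<1}. modulus_at u x \<Omega> r / ennreal r \<partial>lborel)
      \<le> (\<integral>\<^sup>+r\<in>{0<..<1}. modulus_on u \<Omega> r / ennreal r \<partial>lborel)"
    unfolding divide_ennreal_def
    by (intro nn_integral_mono mult_right_mono modulus_at_le_modulus_on assms(2)) auto
  then show ?thesis
    using assms(1) unfolding uniformly_dini_continuous_on_def dini_continuous_at_def by order
qed

text \<open>A finite Dini integral forces the modulus to vanish at 0, since the dyadic bound
  controls its value at \<open>t / 2\<close> by the integral over \<open>{0<..<t}\<close>.
  Continuity of \<open>u\<close> is needed both for the term \<open>rho_const DIM('a) * u x\<close>
  and for the value \<open>u x\<close> in the far part of the integrand.\<close>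

lemma uniformly_dini_imp_continuous_on:
  assumes "uniformly_dini_continuous_on u \<Omega>"
  shows "continuous_on \<Omega> u"
  unfolding continuous_on_iff
proof (intro ballI allI impI)
  fix x and e :: real assume x: "x \<in> \<Omega>" and e: "0 < e"
  let ?m = "modulus_on u \<Omega>"
  \<comment> \<open>Half of \<open>e\<close> makes up for the factor 2 in the dyadic bound.\<close>
  obtain t where t: "0 < t" "(\<integral>\<^sup>+r\<in>{0<..<t}. ?m r / ennreal r \<partial>lborel) < ennreal (e / 2)"
    using dini_integral_small[OF mono_modulus_on, of u \<Omega> "e / 2"] assms e
    unfolding uniformly_dini_continuous_on_def by auto
  have "?m (t / 2) \<le> 2 * (\<integral>\<^sup>+r\<in>{t/2<..<2 * (t/2)}. ?m r / ennreal r \<partial>lborel)"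
    using t by (intro mono_le_dyadic_nn_integral mono_modulus_on) auto
  also have "\<dots> \<le> 2 * (\<integral>\<^sup>+r\<in>{0<..<t}. ?m r / ennreal r \<partial>lborel)"
    using t by (intro mult_left_mono nn_integral_mono) (auto simp: indicator_def)
  also have "\<dots> < 2 * ennreal (e / 2)"
    using t by (intro ennreal_mult_strict_left_mono) auto
  also have "\<dots> = ennreal e"
    using ennreal_mult[of 2 "e / 2"] e by simp
  finally have small: "?m (t / 2) < ennreal e" .
  show "\<exists>d>0. \<forall>x'\<in>\<Omega>. dist x' x < d \<longrightarrow> dist (u x') (u x) < e"
  proof (intro exI[of _ "t / 2"] conjI ballI impI)
    fix y assume y: "y \<in> \<Omega>" "dist y x < t / 2"
    have "ennreal \<bar>u y - u x\<bar> \<le> modulus_at u x \<Omega> (norm (y - x))"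
      using y by (intro modulus_at_upper)
    also have "\<dots> \<le> ?m (norm (y - x))"
      using x by (rule modulus_at_le_modulus_on)
    also have "\<dots> \<le> ?m (t / 2)"
      using y by (intro monoD[OF mono_modulus_on]) (simp add: dist_norm)
    also note small
    finally show "dist (u y) (u x) < e"
      by (simp add: dist_real_def ennreal_less_iff)
  qed (use t in auto)
qed

section \<open>Measurability and the weighted space\<close>

text \<open>Truncations to the compact balls \<open>cball 0 n\<close> are integrable, hence
  measurable, and at each point they eventually agree with \<open>u\<close>.\<close>

lemma locally_integrable_borel_measurable:
  fixes u :: "'a::euclidean_space \<Rightarrow> real"
  assumes "locally_integrable u"
  shows "u \<in> borel_measurable lebesgue"
proof (rule borel_measurable_LIMSEQ_metric)
  show "(\<lambda>y. indicator (cball 0 (real n)) y *\<^sub>R u y) \<in> borel_measurable lebesgue" for n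
    using assms unfolding locally_integrable_def set_integrable_def
    by (intro borel_measurable_integrable) simp
  show "(\<lambda>n. indicator (cball 0 (real n)) y *\<^sub>R u y) \<longlonglongrightarrow> u y" for y
  proof (rule tendsto_eventually)
    show "\<forall>\<^sub>F n in sequentially. indicator (cball 0 (real n)) y *\<^sub>R u y = u y"
      using eventually_ge_at_top[of "nat \<lceil>norm y\<rceil>"]
      by eventually_elim (auto simp: indicator_def nat_le_iff ceiling_le_iff)
  qed
qed

lemma L10_borel_measurable: "u \<in> L10 \<Longrightarrow> u \<in> borel_measurable lebesgue"
  by (simp add: L10_def locally_integrable_borel_measurable)

lemma L_Delta_integrand_borel_measurable:
  fixes u :: "'a::euclidean_space \<Rightarrow> real"
  assumes "u \<in> L10"
  shows "L_Delta_integrand u x \<in> borel_measurable lebesgue"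
proof -
  note [measurable] = L10_borel_measurable[OF assms]
  have [measurable]: "(\<lambda>y. u x * indicator (ball x 1) y) \<in> borel_measurable lebesgue"
    by (intro borel_measurable_times borel_measurable_const borel_measurable_indicator) simp
  have [measurable]: "(\<lambda>y. norm (x - y) ^ DIM('a)) \<in> borel_measurable lebesgue"
    by (intro measurable_completion) measurable
  show ?thesis
    unfolding L_Delta_integrand_def by measurable
qed

lemma L10_integrable_weighted:
  fixes u :: "'a::euclidean_space \<Rightarrow> real"
  assumes "u \<in> L10"
  shows "integrable lebesgue (\<lambda>y. \<bar>u y\<bar> / (1 + norm y) ^ DIM('a))"
proof (rule integrableI_bounded)
  note [measurable] = L10_borel_measurable[OF assms]
  have [measurable]: "(\<lambda>y::'a. (1 + norm y) ^ DIM('a)) \<in> borel_measurable lebesgue"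
    by (intro measurable_completion) measurable
  show "(\<lambda>y. \<bar>u y\<bar> / (1 + norm y) ^ DIM('a)) \<in> borel_measurable lebesgue"
    by measurable
  show "(\<integral>\<^sup>+ x. ennreal (norm (\<bar>u x\<bar> / (1 + norm x) ^ DIM('a))) \<partial>lebesgue) < \<infinity>"
    using assms by (simp add: L10_def L10_norm_def)
qed

section \<open>Estimates near the singularity and away from it\<close>

text \<open>As \<open>\<delta> \<le> 1\<close>, the indicator of the unit ball is 1 on
  \<open>ball x \<delta>\<close>, so the numerator is \<open>u x - u y\<close> and the radial
  estimate applies. The modulus \<open>m\<close> is left abstract to serve for both
  \<open>modulus_at\<close> and \<open>modulus_on\<close>.\<close>

lemma near_integrand_le:
  fixes u :: "'a::euclidean_space \<Rightarrow> real"
  assumes m: "mono m" and \<delta>: "\<delta> \<le> 1"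
    and bound: "\<And>y. y \<in> ball x \<delta> \<Longrightarrow> ennreal \<bar>u y - u x\<bar> \<le> m (norm (y - x))"
  shows "(\<integral>\<^sup>+y\<in>ball x \<delta>. ennreal \<bar>L_Delta_integrand u x y\<bar> \<partial>lebesgue)
    \<le> ennreal (2 ^ (DIM('a) + 1) * unit_ball_vol (real DIM('a)))
        * (\<integral>\<^sup>+r\<in>{0<..<2 * \<delta>}. m r / ennreal r \<partial>lborel)"
proof -
  have "(\<integral>\<^sup>+y\<in>ball x \<delta>. ennreal \<bar>L_Delta_integrand u x y\<bar> \<partial>lebesgue)
      \<le> (\<integral>\<^sup>+y\<in>ball x \<delta>. m (norm (y - x)) * ennreal (1 / norm (y - x) ^ DIM('a)) \<partial>lebesgue)"
  proof (rule nn_integral_mono)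
    fix y
    show "ennreal \<bar>L_Delta_integrand u x y\<bar> * indicator (ball x \<delta>) y
        \<le> m (norm (y - x)) * ennreal (1 / norm (y - x) ^ DIM('a)) * indicator (ball x \<delta>) y"
    proof (cases "y \<in> ball x \<delta>")
      case True
      then have "y \<in> ball x 1" using \<delta> by auto
      then have "\<bar>L_Delta_integrand u x y\<bar> = \<bar>u y - u x\<bar> * (1 / norm (y - x) ^ DIM('a))"
        by (simp add: L_Delta_integrand_def norm_minus_commute abs_minus_commute)
      then have "ennreal \<bar>L_Delta_integrand u x y\<bar>
          = ennreal \<bar>u y - u x\<bar> * ennreal (1 / norm (y - x) ^ DIM('a))"
        by (simp only: ennreal_mult abs_ge_zero zero_le_divide_1_iff zero_le_power norm_ge_zero)
      also have "\<dots> \<le> m (norm (y - x)) * ennreal (1 / norm (y - x) ^ DIM('a))"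
        using bound[OF True] by (rule mult_right_mono) simp
      finally show ?thesis using True by simp
    qed simp
  qed
  also have "\<dots> = (\<integral>\<^sup>+y\<in>ball x \<delta>. m (norm (y - x)) * ennreal (1 / norm (y - x) ^ DIM('a)) \<partial>lborel)"
    by (rule nn_integral_completion)
  also note nn_integral_radial_le[OF m]
  finally show ?thesis .
qed

text \<open>The majorant depends on \<open>x\<close> only through \<open>R\<close> and
  \<open>M\<close>, so that it dominates along a whole sequence of centers. The term in
  \<open>u x\<close> lives on the unit ball around \<open>x\<close>, contained in
  \<open>cball 0 (R + 1)\<close>; the term in \<open>u y\<close> is compared with the weight of
  \<open>L10\<close>.\<close>

lemma far_integrand_le:
  fixes u :: "'a::euclidean_space \<Rightarrow> real"
  assumes R: "norm x \<le> R" and M: "\<bar>u x\<bar> \<le> M" and \<delta>: "0 < \<delta>"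
  shows "\<bar>L_Delta_integrand u x y * indicator (- ball x \<delta>) y\<bar>
    \<le> M / \<delta> ^ DIM('a) * indicator (cball 0 (R + 1)) y
      + ((R + 1) / \<delta> + 1) ^ DIM('a) * (\<bar>u y\<bar> / (1 + norm y) ^ DIM('a))"
proof (cases "y \<in> ball x \<delta>")
  case True
  have "0 \<le> M" "0 \<le> R" using R M norm_ge_zero[of x] by linarith+
  with True \<delta> show ?thesis by (auto intro!: add_nonneg_nonneg mult_nonneg_nonneg)
next
  case False
  let ?N = "DIM('a)" and ?d = "norm (x - y)"
  have d: "\<delta> \<le> ?d" "0 < ?d" using False \<delta> by (auto simp: dist_norm)
  have R0: "0 \<le> R" using R norm_ge_zero[of x] by linarith
  have "\<bar>L_Delta_integrand u x y\<bar> \<le> \<bar>u x\<bar> * indicator (ball x 1) y / ?d ^ ?N + \<bar>u y\<bar> / ?d ^ ?N"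
    unfolding L_Delta_integrand_def
    by (auto simp: abs_mult indicator_def add_divide_distrib[symmetric] intro!: divide_right_mono)
  moreover have "\<bar>u x\<bar> * indicator (ball x 1) y / ?d ^ ?N \<le> M / \<delta> ^ ?N * indicator (cball 0 (R + 1)) y"
  proof (cases "y \<in> ball x 1")
    case True
    then have "norm y \<le> R + 1"
      using R norm_triangle_sub[of y x] by (simp add: dist_norm norm_minus_commute)
    moreover have "\<bar>u x\<bar> / ?d ^ ?N \<le> M / \<delta> ^ ?N"
      using M \<delta> d by (intro frac_le power_mono) auto
    ultimately show ?thesis using True by simp
  qed (use M \<delta> in \<open>auto simp: indicator_def\<close>)
  moreover have "\<bar>u y\<bar> / ?d ^ ?N \<le> ((R + 1) / \<delta> + 1) ^ ?N * (\<bar>u y\<bar> / (1 + norm y) ^ ?N)"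
  proof -
    have "1 + norm y \<le> (R + 1) + ?d"
      using R norm_triangle_sub[of y x] by (simp add: norm_minus_commute)
    \<comment> \<open>Off the ball \<open>?d / \<delta>\<close> is at least 1, so the constant
      \<open>R + 1\<close> is absorbed into a multiple of the distance.\<close>
    also have "\<dots> \<le> (R + 1) * (?d / \<delta>) + ?d"
      using d \<delta> R0 by (auto intro!: mult_left_mono[of 1 "?d / \<delta>" "R + 1", simplified])
    also have "\<dots> = ((R + 1) / \<delta> + 1) * ?d"
      by (simp add: algebra_simps)
    finally have "(1 + norm y) ^ ?N \<le> ((R + 1) / \<delta> + 1) ^ ?N * ?d ^ ?N"
      unfolding power_mult_distrib[symmetric] by (intro power_mono) auto
    then have "1 / ?d ^ ?N \<le> ((R + 1) / \<delta> + 1) ^ ?N / (1 + norm y) ^ ?N"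
      using d by (simp add: divide_simps add_pos_nonneg)
    then have "\<bar>u y\<bar> * (1 / ?d ^ ?N) \<le> \<bar>u y\<bar> * (((R + 1) / \<delta> + 1) ^ ?N / (1 + norm y) ^ ?N)"
      by (rule mult_left_mono) simp
    then show ?thesis by (simp add: mult.commute)
  qed
  ultimately show ?thesis using False by simp
qed

lemma far_majorant_integrable:
  fixes u :: "'a::euclidean_space \<Rightarrow> real"
  assumes "u \<in> L10"
  shows "integrable lebesgue (\<lambda>y. a * indicator (cball 0 r) y + b * (\<bar>u y\<bar> / (1 + norm y) ^ DIM('a)))"
proof -
  have "integrable lebesgue (\<lambda>y::'a. a * indicator (cball 0 r) y)"
    by (intro integrable_mult_right integrable_real_indicator)
      (use emeasure_lborel_cball_finite[of "0::'a" r] in auto)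
  from this integrable_mult_right[OF L10_integrable_weighted[OF assms]] show ?thesis
    by (rule Bochner_Integration.integrable_add)
qed

lemma far_integrand_borel_measurable:
  fixes u :: "'a::euclidean_space \<Rightarrow> real"
  assumes "u \<in> L10"
  shows "(\<lambda>y. L_Delta_integrand u x y * indicator (- ball x \<delta>) y) \<in> borel_measurable lebesgue"
proof -
  note [measurable] = L_Delta_integrand_borel_measurable[OF assms]
  have [measurable]: "ball x \<delta> \<in> sets lebesgue" by simp
  show ?thesis by measurable
qed

lemma far_integrand_integrable:
  fixes u :: "'a::euclidean_space \<Rightarrow> real"
  assumes "u \<in> L10" and \<delta>: "0 < \<delta>"
  shows "integrable lebesgue (\<lambda>y. L_Delta_integrand u x y * indicator (- ball x \<delta>) y)"
proof (rule Bochner_Integration.integrable_bound[OF far_majorant_integrable[OF assms(1)]])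
  show "AE y in lebesgue. norm (L_Delta_integrand u x y * indicator (- ball x \<delta>) y)
      \<le> norm (\<bar>u x\<bar> / \<delta> ^ DIM('a) * indicator (cball 0 (norm x + 1)) y
          + ((norm x + 1) / \<delta> + 1) ^ DIM('a) * (\<bar>u y\<bar> / (1 + norm y) ^ DIM('a)))"
  proof (rule AE_I2)
    show "norm (L_Delta_integrand u x y * indicator (- ball x \<delta>) y)
      \<le> norm (\<bar>u x\<bar> / \<delta> ^ DIM('a) * indicator (cball 0 (norm x + 1)) y
          + ((norm x + 1) / \<delta> + 1) ^ DIM('a) * (\<bar>u y\<bar> / (1 + norm y) ^ DIM('a)))" for y
      using far_integrand_le[of x "norm x" u "\<bar>u x\<bar>" \<delta> y] \<delta> by simp
  qed
qed (rule far_integrand_borel_measurable[OF assms(1)])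

section \<open>Existence of the integral\<close>

text \<open>The integrand is split at a small ball inside \<open>\<Omega>\<close>: the Dini integral
  bounds the inside, the weighted norm the outside. Allowing any open \<open>\<Omega>\<close> covers
  the whole space as well as the uniform case.\<close>

lemma dini_imp_L_Delta_defined:
  fixes u :: "'a::euclidean_space \<Rightarrow> real"
  assumes u: "u \<in> L10" and \<Omega>: "open \<Omega>" "x \<in> \<Omega>" and dini: "dini_continuous_at u \<Omega> x"
  shows "L_Delta_defined u x"
proof -
  obtain d where d: "0 < d" "ball x d \<subseteq> \<Omega>"
    using \<Omega> by (auto simp: open_contains_ball)
  \<comment> \<open>The bound \<open>1/2\<close> keeps the radii below \<open>2 * \<delta>\<close>
    within the range \<open>{0<..<1}\<close> of the Dini integral.\<close>
  define \<delta> where "\<delta> = min d (1/2)"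
  have \<delta>: "0 < \<delta>" "\<delta> \<le> 1/2" "ball x \<delta> \<subseteq> \<Omega>"
    using d by (auto simp: \<delta>_def)
  let ?I = "L_Delta_integrand u x" and ?C = "ennreal (2 ^ (DIM('a) + 1) * unit_ball_vol (real DIM('a)))"
  note [measurable] = L_Delta_integrand_borel_measurable[OF u]
  have [measurable]: "ball x \<delta> \<in> sets lebesgue" by simp
  have "(\<integral>\<^sup>+y\<in>ball x \<delta>. ennreal \<bar>?I y\<bar> \<partial>lebesgue)
      \<le> ?C * (\<integral>\<^sup>+r\<in>{0<..<2 * \<delta>}. modulus_at u x \<Omega> r / ennreal r \<partial>lborel)"
    using \<delta> by (intro near_integrand_le mono_modulus_at modulus_at_upper) auto
  also have "\<dots> \<le> ?C * (\<integral>\<^sup>+r\<in>{0<..<1}. modulus_at u x \<Omega> r / ennreal r \<partial>lborel)"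
    using \<delta> by (intro mult_left_mono nn_integral_mono) (auto simp: indicator_def)
  also have "\<dots> < \<infinity>"
    using dini by (simp add: dini_continuous_at_def ennreal_mult_less_top)
  finally have near: "(\<integral>\<^sup>+y\<in>ball x \<delta>. ennreal \<bar>?I y\<bar> \<partial>lebesgue) < \<infinity>" .
  have "integrable lebesgue (\<lambda>y. ?I y * indicator (ball x \<delta>) y)"
  proof (rule integrableI_bounded)
    have "(\<integral>\<^sup>+y. ennreal (norm (?I y * indicator (ball x \<delta>) y)) \<partial>lebesgue)
        = (\<integral>\<^sup>+y\<in>ball x \<delta>. ennreal \<bar>?I y\<bar> \<partial>lebesgue)"
      by (rule nn_integral_cong) (auto simp: indicator_def)
    with near show "(\<integral>\<^sup>+y. ennreal (norm (?I y * indicator (ball x \<delta>) y)) \<partial>lebesgue) < \<infinity>"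
      by simp
  qed measurable
  from Bochner_Integration.integrable_add[OF this far_integrand_integrable[OF u \<delta>(1)]]
  have "integrable lebesgue (\<lambda>y. ?I y * indicator (ball x \<delta>) y + ?I y * indicator (- ball x \<delta>) y)" .
  moreover have "(\<lambda>y. ?I y * indicator (ball x \<delta>) y + ?I y * indicator (- ball x \<delta>) y) = ?I"
    by (auto simp: indicator_def)
  ultimately show ?thesis
    by (simp add: L_Delta_defined_def)
qed

section \<open>Continuity of the integral in its center\<close>

text \<open>The two integrands differ exactly on \<open>ball x \<delta>\<close>, so the error of the
  truncation is at most the integral of the absolute value there.\<close>

lemma integral_near_part_le:
  fixes u :: "'a::euclidean_space \<Rightarrow> real"
  assumes u: "u \<in> L10" and \<delta>: "0 < \<delta>" and int: "L_Delta_defined u x" and e: "0 \<le> e"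
    and le: "(\<integral>\<^sup>+y\<in>ball x \<delta>. ennreal \<bar>L_Delta_integrand u x y\<bar> \<partial>lebesgue) \<le> ennreal e"
  shows "\<bar>(\<integral>y. L_Delta_integrand u x y \<partial>lebesgue)
      - (\<integral>y. L_Delta_integrand u x y * indicator (- ball x \<delta>) y \<partial>lebesgue)\<bar> \<le> e"
proof -
  let ?I = "L_Delta_integrand u x"
  let ?D = "\<lambda>y. ?I y - ?I y * indicator (- ball x \<delta>) y"
  have I: "integrable lebesgue ?I"
    using int by (simp add: L_Delta_defined_def)
  note F = far_integrand_integrable[OF u \<delta>, of x]
  have "ennreal (norm (integral\<^sup>L lebesgue ?D)) \<le> (\<integral>\<^sup>+y. norm (?D y) \<partial>lebesgue)"
    by (intro integral_norm_bound_ennreal Bochner_Integration.integrable_diff I F)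
  also have "\<dots> = (\<integral>\<^sup>+y\<in>ball x \<delta>. ennreal \<bar>?I y\<bar> \<partial>lebesgue)"
    by (rule nn_integral_cong) (auto simp: indicator_def)
  also note le
  finally show ?thesis
    using e by (simp add: Bochner_Integration.integral_diff[OF I F])
qed

text \<open>Dominated convergence: convergent sequences are bounded, which yields \<open>R\<close>
  and \<open>M\<close> for the majorant. For fixed \<open>y\<close> only the center, its value under
  \<open>u\<close> and the two indicators vary, and the indicators settle unless \<open>y\<close>
  lies on a limiting sphere.\<close>

lemma integral_far_part_tendsto:
  fixes u :: "'a::euclidean_space \<Rightarrow> real"
  assumes u: "u \<in> L10" and \<delta>: "0 < \<delta>" and X: "X \<longlonglongrightarrow> x" and uX: "(\<lambda>n. u (X n)) \<longlonglongrightarrow> u x"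
  shows "(\<lambda>n. \<integral>y. L_Delta_integrand u (X n) y * indicator (- ball (X n) \<delta>) y \<partial>lebesgue)
    \<longlonglongrightarrow> (\<integral>y. L_Delta_integrand u x y * indicator (- ball x \<delta>) y \<partial>lebesgue)"
proof -
  obtain R where R: "\<And>n. norm (X n) \<le> R"
    using convergent_imp_Bseq[OF convergentI[OF X]] by (metis BseqE)
  obtain M where M: "\<And>n. \<bar>u (X n)\<bar> \<le> M"
    using convergent_imp_Bseq[OF convergentI[OF uX]] by (metis BseqE real_norm_def)
  have sphere: "AE y in lebesgue. y \<notin> sphere x r" for r
    using negligible_sphere[of x r] by (intro AE_not_in) (simp add: negligible_iff_null_sets)
  have ind: "\<forall>\<^sub>F n in sequentially. (indicator (ball (X n) r) y :: real) = indicator (ball x r) y"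
    if "y \<notin> sphere x r" for y r
  proof -
    have lim: "(\<lambda>n. dist (X n) y) \<longlonglongrightarrow> dist x y"
      using X by (intro tendsto_intros)
    consider "dist x y < r" | "r < dist x y" using \<open>y \<notin> sphere x r\<close> by (metis linorder_neqE mem_sphere)
    then show ?thesis
    proof cases
      case 1
      then show ?thesis
        using order_tendstoD(2)[OF lim 1] by (auto elim!: eventually_mono)
    next
      case 2
      then show ?thesis
        using order_tendstoD(1)[OF lim 2] by (auto elim!: eventually_mono simp: indicator_def)
    qed
  qed
  show ?thesis
  proof (rule integral_dominated_convergence[where w =
      "\<lambda>y. M / \<delta> ^ DIM('a) * indicator (cball 0 (R + 1)) y
        + ((R + 1) / \<delta> + 1) ^ DIM('a) * (\<bar>u y\<bar> / (1 + norm y) ^ DIM('a))"])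
    show "AE y in lebesgue. (\<lambda>n. L_Delta_integrand u (X n) y * indicator (- ball (X n) \<delta>) y)
        \<longlonglongrightarrow> L_Delta_integrand u x y * indicator (- ball x \<delta>) y"
      \<comment> \<open>Radii \<open>\<delta>\<close> and 1 are where the indicators jump; radius 0
        removes \<open>y = x\<close>, where the denominator vanishes.\<close>
      using sphere[of \<delta>] sphere[of 1] sphere[of 0]
    proof eventually_elim
      case (elim y)
      have i1: "(\<lambda>n. indicator (ball (X n) 1) y :: real) \<longlonglongrightarrow> indicator (ball x 1) y"
        by (rule tendsto_eventually[OF ind[OF elim(2)]])
      have "(\<lambda>n. indicator (ball (X n) \<delta>) y :: real) \<longlonglongrightarrow> indicator (ball x \<delta>) y"
        by (rule tendsto_eventually[OF ind[OF elim(1)]])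
      then have i2: "(\<lambda>n. indicator (- ball (X n) \<delta>) y :: real) \<longlonglongrightarrow> indicator (- ball x \<delta>) y"
        unfolding indicator_compl by (intro tendsto_intros)
      show ?case
        unfolding L_Delta_integrand_def
        using elim(3) by (intro tendsto_intros i1 i2 uX X) auto
    qed
    show "AE y in lebesgue. norm (L_Delta_integrand u (X n) y * indicator (- ball (X n) \<delta>) y)
      \<le> M / \<delta> ^ DIM('a) * indicator (cball 0 (R + 1)) y
        + ((R + 1) / \<delta> + 1) ^ DIM('a) * (\<bar>u y\<bar> / (1 + norm y) ^ DIM('a))" for n
      using far_integrand_le[of "X n" R u M \<delta>, OF R M \<delta>] by simp
  qed (simp_all only: far_integrand_borel_measurable[OF u] far_majorant_integrable[OF u])
qed

text \<open>A three-part estimate: the truncation error is at most \<open>e / 3\<close> at every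
  center near \<open>x\<close>, with the same \<open>\<delta>\<close>, because
  \<open>modulus_on\<close> does not depend on the center. With \<open>\<delta>\<close> fixed, the
  far parts converge.\<close>

lemma uniformly_dini_imp_continuous_on_L_Delta:
  fixes u :: "'a::euclidean_space \<Rightarrow> real"
  assumes u: "u \<in> L10" and \<Omega>: "open \<Omega>" and dini: "uniformly_dini_continuous_on u \<Omega>"
  shows "continuous_on \<Omega> (L_Delta u)"
proof (rule continuous_on_sequentiallyI)
  fix X x assume X\<Omega>: "\<forall>n. X n \<in> \<Omega>" and x: "x \<in> \<Omega>" and X: "X \<longlonglongrightarrow> x"
  let ?m = "modulus_on u \<Omega>" and ?c = "2 ^ (DIM('a) + 1) * unit_ball_vol (real DIM('a))"
  let ?J = "\<lambda>x. \<integral>y. L_Delta_integrand u x y \<partial>lebesgue"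
  have uX: "(\<lambda>n. u (X n)) \<longlonglongrightarrow> u x"
    using uniformly_dini_imp_continuous_on[OF dini] X X\<Omega> x
    by (auto simp: continuous_on_sequentially o_def)
  have "(\<lambda>n. ?J (X n)) \<longlonglongrightarrow> ?J x"
  proof (rule LIMSEQ_I)
    fix e :: real assume e: "0 < e"
    have c: "0 < ?c" by simp
    have cancel: "ennreal a * ennreal (b / a) = ennreal b" if "0 < a" "0 \<le> b" for a b
      using that by (subst ennreal_mult[symmetric]) auto
    \<comment> \<open>Dividing by \<open>?c\<close> cancels the constant of the radial
      estimate.\<close>
    obtain t where t: "0 < t" "t \<le> 1"
        "(\<integral>\<^sup>+r\<in>{0<..<t}. ?m r / ennreal r \<partial>lborel) < ennreal (e / 3 / ?c)"
      using dini_integral_small[OF mono_modulus_on, of u \<Omega> "e / 3 / ?c"] dini e c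
      unfolding uniformly_dini_continuous_on_def by auto
    obtain d where d: "0 < d" "ball x d \<subseteq> \<Omega>"
      using \<Omega> x by (auto simp: open_contains_ball)
    \<comment> \<open>\<open>t / 2\<close> keeps the doubled radius of the radial estimate within
      \<open>t\<close>; \<open>d / 2\<close> keeps \<open>ball z \<delta>\<close> inside
      \<open>ball x d\<close> for all \<open>z\<close> within \<open>\<delta>\<close> of
      \<open>x\<close>.\<close>
    define \<delta> where "\<delta> = min (d / 2) (t / 2)"
    have \<delta>: "0 < \<delta>" "\<delta> \<le> 1" "2 * \<delta> \<le> t" "2 * \<delta> \<le> d"
      using d t by (auto simp: \<delta>_def)
    let ?G = "\<lambda>x. \<integral>y. L_Delta_integrand u x y * indicator (- ball x \<delta>) y \<partial>lebesgue"
    have near: "\<bar>?J z - ?G z\<bar> \<le> e / 3" if "z \<in> ball x \<delta>" for z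
    proof -
      have sub: "ball z \<delta> \<subseteq> \<Omega>"
      proof
        fix y assume "y \<in> ball z \<delta>"
        then have "y \<in> ball x d"
          using that \<delta>(4) dist_triangle[of x y z] by simp
        then show "y \<in> \<Omega>" using d by blast
      qed
      then have z: "z \<in> \<Omega>" using \<delta> by auto
      have "(\<integral>\<^sup>+y\<in>ball z \<delta>. ennreal \<bar>L_Delta_integrand u z y\<bar> \<partial>lebesgue)
          \<le> ennreal ?c * (\<integral>\<^sup>+r\<in>{0<..<2 * \<delta>}. ?m r / ennreal r \<partial>lborel)"
      proof (rule near_integrand_le[OF mono_modulus_on \<delta>(2)])
        show "ennreal \<bar>u y - u z\<bar> \<le> ?m (norm (y - z))" if "y \<in> ball z \<delta>" for y
          using that sub modulus_at_upper[of y \<Omega> u z] modulus_at_le_modulus_on[OF z]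
          by (blast intro: order.trans)
      qed
      also have "\<dots> \<le> ennreal ?c * (\<integral>\<^sup>+r\<in>{0<..<t}. ?m r / ennreal r \<partial>lborel)"
        using \<delta> by (intro mult_left_mono nn_integral_mono) (auto simp: indicator_def)
      also have "\<dots> \<le> ennreal ?c * ennreal (e / 3 / ?c)"
        using t by (intro mult_left_mono) auto
      also have "\<dots> = ennreal (e / 3)"
        by (rule cancel) (use c e in auto)
      finally have "(\<integral>\<^sup>+y\<in>ball z \<delta>. ennreal \<bar>L_Delta_integrand u z y\<bar> \<partial>lebesgue) \<le> ennreal (e / 3)" .
      moreover have "L_Delta_defined u z"
        using dini_imp_L_Delta_defined[OF u \<Omega> z] uniformly_dini_imp_dini[OF dini z] .
      ultimately show ?thesis
        using e by (intro integral_near_part_le u \<delta>) auto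
    qed
    have "\<forall>\<^sub>F n in sequentially. dist (X n) x < \<delta>"
      using X \<delta> by (simp add: tendsto_iff)
    moreover have "\<forall>\<^sub>F n in sequentially. dist (?G (X n)) (?G x) < e / 3"
      by (rule tendstoD[OF integral_far_part_tendsto[OF u \<delta>(1) X uX]]) (use e in simp)
    ultimately have "\<forall>\<^sub>F n in sequentially. norm (?J (X n) - ?J x) < e"
    proof eventually_elim
      case (elim n)
      have "\<bar>?J (X n) - ?G (X n)\<bar> \<le> e / 3" "\<bar>?J x - ?G x\<bar> \<le> e / 3"
        using elim \<delta> by (intro near; simp add: dist_commute)+
      with elim(2) show ?case unfolding dist_real_def real_norm_def by linarith
    qed
    then show "\<exists>no. \<forall>n\<ge>no. norm (?J (X n) - ?J x) < e"
      by (simp add: eventually_sequentially)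
  qed
  then show "(\<lambda>n. L_Delta u (X n)) \<longlonglongrightarrow> L_Delta u x"
    unfolding L_Delta_def by (intro tendsto_intros uX)
qed

text \<open>Continuity is paired with \<open>L_Delta_defined\<close> on \<open>\<Omega>\<close>, so
  that it concerns genuine integrals and not the default value 0.\<close>

theorem proposition1p3:
  fixes u :: "'a::euclidean_space \<Rightarrow> real"
  assumes "u \<in> L10"
  shows "(\<forall>x. dini_continuous_at u UNIV x \<longrightarrow> L_Delta_defined u x) \<and>
         (\<forall>\<Omega>. open \<Omega> \<longrightarrow> uniformly_dini_continuous_on u \<Omega> \<longrightarrow>
            (\<forall>x\<in>\<Omega>. L_Delta_defined u x) \<and> continuous_on \<Omega> (L_Delta u))"
  using assms dini_imp_L_Delta_defined[OF assms open_UNIV UNIV_I]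
    dini_imp_L_Delta_defined[OF assms] uniformly_dini_imp_dini
    uniformly_dini_imp_continuous_on_L_Delta
  by blast

end
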